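(* Let $R$ be a field of characteristic $0$, let $\mathcal{A}$ be a commutative unitary $R$-algebra, and let $\mathcal{L}$ be a strongly non-singular Lie pseudoalgebra over $R$ and $\mathcal{A}$. Then, for every finite-codimensional Lie subalgebra $\mathcal{K}$ of $\mathcal{L}$, there is a finite-codimensional ideal $I$ of $\mathcal{A}$ such that $I\mathcal{L}\subset\mathcal{K}\subset\mathcal{L}_{\bar I}$.
   Context: A Lie pseudoalgebra over $R$ and $\mathcal{A}$ is an $\mathcal{A}$-module $\mathcal{L}$ together with a bracket $[\cdot,\cdot]:\mathcal{L}\times\mathcal{L}\to\mathcal{L}$ and an $\mathcal{A}$-module morphism $a:\mathcal{L}\to\mathrm{Der}(\mathcal{A})$ (the anchor) into the $\mathcal{A}$-module of ($R$-linear) derivations of $\mathcal{A}$, such that: (i) the bracket is $R$-bilinear, alternating and satisfies the Jacobi identity; (ii) $[X,fY]=f[X,Y]+a(X)(f)Y$ for all $X,Y\in\mathcal{L}$, $f\in\mathcal{A}$; (iii) $a([X,Y])=[a(X),a(Y)]$ for all $X,Y\in\mathcal{L}$. The Lie algebra structure of $\mathcal{L}$ is considered over $R$; codimensions are over $R$. Notation: $\hat X=a(X)$. $\mathcal{L}$ is strongly non-singular if $\mathrm{span}\{\hat X(f):X\in\mathcal{L},\ f\in\mathcal{A}\}=\mathcal{A}$. For an ideal $I\subset\mathcal{A}$: $I\mathcal{L}$ is the $\mathcal{A}$-submodule of $\mathcal{L}$ spanned by the products $fX$ ($f\in I$, $X\in\mathcal{L}$), and $\mathcal{L}_I=\{X\in\mathcal{L}:\hat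 X(\mathcal{A})\subset I\}$. $\mathcal{M}(\mathcal{A})$ is the set of all maximal finite-codimensional ideals of $\mathcal{A}$, i.e. maximal elements of the family of finite-codimensional ideals different from $\mathcal{A}$. For $I\subset\mathcal{A}$ put $V(I)=\{J\in\mathcal{M}(\mathcal{A}):I\subset J\}$ and $\bar I=\bigcap_{J\in V(I)}J$ (the empty intersection being $\mathcal{A}$). *)

theory Defs
  imports Complex_Main
begin

(* The sort {comm_ring, comm_monoid_mult} is that of commutative unitary rings, the zero ring
   included; comm_ring_1, and with it the library's locale module over such a ring, would impose
   0 ~= 1. *)

locale commutative_algebra = vector_space scale
  for scale :: "'r::field \<Rightarrow> 'a::{comm_ring,comm_monoid_mult} \<Rightarrow> 'a" +
  assumes scale_mult_left: "scale r (f * g) = scale r f * g"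

locale unital_module =
  fixes act :: "'a::{comm_ring,comm_monoid_mult} \<Rightarrow> 'l::ab_group_add \<Rightarrow> 'l"
  assumes act_add_right: "act f (X + Y) = act f X + act f Y"
    and act_add_left: "act (f + g) X = act f X + act g X"
    and act_act: "act f (act g X) = act (f * g) X"
    and act_one: "act 1 X = X"

definition submodule :: "('a::{comm_ring,comm_monoid_mult} \<Rightarrow> 'l::ab_group_add \<Rightarrow> 'l) \<Rightarrow> 'l set \<Rightarrow> bool"
  where "submodule act N \<longleftrightarrow>
    0 \<in> N \<and> (\<forall>X\<in>N. \<forall>Y\<in>N. X + Y \<in> N) \<and> (\<forall>f. \<forall>X\<in>N. act f X \<in> N)"

definition alg_ideal :: "'a::{comm_ring,comm_monoid_mult} set \<Rightarrow> bool"
  where "alg_ideal I \<longleftrightarrow> submodule (*) I"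

(* The scalar multiplication that a module over an R-algebra inherits from R. *)
definition rscale :: "('r::field \<Rightarrow> 'a::{comm_ring,comm_monoid_mult} \<Rightarrow> 'a) \<Rightarrow>
    ('a \<Rightarrow> 'l::ab_group_add \<Rightarrow> 'l) \<Rightarrow> 'r \<Rightarrow> 'l \<Rightarrow> 'l"
  where "rscale scale act r X = act (scale r 1) X"

lemma vector_space_rscale:
  assumes "commutative_algebra scale" and "unital_module act"
  shows "vector_space (rscale scale act)"
proof -
  interpret A: commutative_algebra scale by fact
  interpret L: unital_module act by fact
  have "scale r 1 * scale s 1 = scale (r * s) 1" for r s
    by (metis A.scale_mult_left A.scale_scale mult_1)
  then show ?thesis
    by unfold_locales
      (simp_all add: rscale_def L.act_add_right L.act_add_left A.scale_left_distrib
        L.act_act L.act_one)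
qed

definition derivation :: "('r::field \<Rightarrow> 'a::{comm_ring,comm_monoid_mult} \<Rightarrow> 'a) \<Rightarrow> ('a \<Rightarrow> 'a) \<Rightarrow> bool"
  where "derivation scale D \<longleftrightarrow>
    Vector_Spaces.linear scale scale D \<and> (\<forall>f g. D (f * g) = D f * g + f * D g)"

locale lie_pseudoalgebra = commutative_algebra scale + unital_module act
  for scale :: "'r::field \<Rightarrow> 'a::{comm_ring,comm_monoid_mult} \<Rightarrow> 'a"
    and act :: "'a \<Rightarrow> 'l::ab_group_add \<Rightarrow> 'l" +
  fixes bracket :: "'l \<Rightarrow> 'l \<Rightarrow> 'l"
    and anchor :: "'l \<Rightarrow> 'a \<Rightarrow> 'a"
  assumes bracket_linear_left:
      "Vector_Spaces.linear (rscale scale act) (rscale scale act) (\<lambda>X. bracket X Y)"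
    and bracket_linear_right:
      "Vector_Spaces.linear (rscale scale act) (rscale scale act) (\<lambda>Y. bracket X Y)"
    and bracket_alternating: "bracket X X = 0"
    and jacobi:
      "bracket X (bracket Y Z) + bracket Y (bracket Z X) + bracket Z (bracket X Y) = 0"
    and anchor_derivation: "derivation scale (anchor X)"
    and anchor_add: "anchor (X + Y) f = anchor X f + anchor Y f"
    and anchor_act: "anchor (act f X) g = f * anchor X g"
    and bracket_act: "bracket X (act f Y) = act f (bracket X Y) + act (anchor X f) Y"
    and anchor_bracket: "anchor (bracket X Y) f = anchor X (anchor Y f) - anchor Y (anchor X f)"

(* The span is over R; the spanning set is closed under multiplication by the algebra, so the
   ideal it generates is the same set. *)
definition strongly_nonsingular ::
    "('r::field \<Rightarrow> 'a::{comm_ring,comm_monoid_mult} \<Rightarrow> 'a) \<Rightarrow> ('l \<Rightarrow> 'a \<Rightarrow> 'a) \<Rightarrow> bool"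
  where "strongly_nonsingular scale anchor \<longleftrightarrow>
    module.span scale {anchor X f | X f. True} = UNIV"

definition lie_subalgebra ::
    "('r::field \<Rightarrow> 'l::ab_group_add \<Rightarrow> 'l) \<Rightarrow> ('l \<Rightarrow> 'l \<Rightarrow> 'l) \<Rightarrow> 'l set \<Rightarrow> bool"
  where "lie_subalgebra scl bracket K \<longleftrightarrow>
    module.subspace scl K \<and> (\<forall>X\<in>K. \<forall>Y\<in>K. bracket X Y \<in> K)"

(* For a subspace W: the quotient by W is spanned by the classes of finitely many vectors. *)
definition finite_codim :: "('r::field \<Rightarrow> 'v::ab_group_add \<Rightarrow> 'v) \<Rightarrow> 'v set \<Rightarrow> bool"
  where "finite_codim scl W \<longleftrightarrow>
    (\<exists>B. finite B \<and> {w + v | w v. w \<in> W \<and> v \<in> module.span scl B} = UNIV)"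

definition ideal_times ::
    "('a::{comm_ring,comm_monoid_mult} \<Rightarrow> 'l::ab_group_add \<Rightarrow> 'l) \<Rightarrow> 'a set \<Rightarrow> 'l set"
  where "ideal_times act I = submodule act hull {act f X | f X. f \<in> I}"

definition anchor_into :: "('l \<Rightarrow> 'a \<Rightarrow> 'a) \<Rightarrow> 'a set \<Rightarrow> 'l set"
  where "anchor_into anchor I = {X. range (anchor X) \<subseteq> I}"

definition max_ideals :: "('r::field \<Rightarrow> 'a::{comm_ring,comm_monoid_mult} \<Rightarrow> 'a) \<Rightarrow> 'a set set"
  where "max_ideals scale =
    {J. alg_ideal J \<and> finite_codim scale J \<and> J \<noteq> UNIV \<and>
        (\<forall>J'. alg_ideal J' \<and> finite_codim scale J' \<and> J' \<noteq> UNIV \<and> J \<subseteq> J' \<longrightarrow> J' = J)}"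

definition zero_locus ::
    "('r::field \<Rightarrow> 'a::{comm_ring,comm_monoid_mult} \<Rightarrow> 'a) \<Rightarrow> 'a set \<Rightarrow> 'a set set"
  where "zero_locus scale I = {J \<in> max_ideals scale. I \<subseteq> J}"

definition ideal_bar ::
    "('r::field \<Rightarrow> 'a::{comm_ring,comm_monoid_mult} \<Rightarrow> 'a) \<Rightarrow> 'a set \<Rightarrow> 'a set"
  where "ideal_bar scale I = \<Inter> (zero_locus scale I)"

end

theory Submission
  imports Defs
begin

text \<open>
  The ideal $I$ is the conductor of $K$, the set of all $f$ with $f L \subseteq K$, where $L$ is
  the pseudoalgebra. It is the largest ideal with $I L \subseteq K$, so what has to be proved is
  that it has finite codimension and that the anchors of elements of $K$ map the algebra into
  $\bar I$.

  Finite codimension is the content of \<open>conductor_finite_codim\<close>. Write $K_1$ for the set of $X \in K$ with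
  $[X, L] \subseteq K$. It is the kernel of the action of $K$ on the finite-dimensional space
  $L/K$, hence again a subalgebra of finite codimension (\<open>core_finite_codim\<close>), and so is
  $K_2 = (K_1)_1$. Two identities move algebra elements into $I$:

  \<^item> $[hX, fgX] - [hfX, gX] = 2 g h \hat X(f) X$. If $hX$ and $hfX$ lie in $K_2$, then all algebra
    multiples of $Z = h \hat X(f) X$ lie in $K_1$ (\<open>anchor_multiple_in_subalgebra\<close>).

  \<^item> $\hat Z(g) Y = [Z, gY] - [gZ, Y] - \hat Y(g) Z$. If all algebra multiples of $Z$ lie in
    $K_1$, then $\hat Z(g) Y \in K$ for all $Y$, that is, $\hat Z(g) \in I$
    (\<open>anchor_in_conductor\<close>).

  Together they give $h \hat X(f)^2 \in I$ whenever $hX, hfX \in K_2$, a condition that holds for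
  all $h$ in a subspace of finite codimension depending on $X$ and $f$. Strong non-singularity
  writes $1$ as a linear combination of finitely many $\hat X_i(f_i)$, so a single subspace $U$ of
  finite codimension serves for all of them. The squares of the $\hat X_i(f_i)$ generate the unit
  ideal, therefore $U \subseteq I$. It matters that the first identity is linear in $h$: products
  of elements of $U$ need not span a subspace of finite codimension.

  For the second inclusion, if $X \in K$ then the derivation $\hat X$ preserves $I$. Every derivation that
  preserves an ideal of finite codimension maps the whole algebra into each prime ideal above it
  (\<open>derivation_into_prime\<close>), which is applied to the maximal ideals in $V(I)$.
\<close>

section \<open>Subspaces of finite codimension\<close>

lemma finite_codim_mono:
  assumes "finite_codim scl W" and "W \<subseteq> W'"
  shows "finite_codim scl W'"
proof -
  obtain B where "finite B" and "{w + v | w v. w \<in> W \<and> v \<in> module.span scl B} = UNIV"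
    using assms(1) unfolding finite_codim_def by blast
  moreover from this assms(2) have "{w + v | w v. w \<in> W' \<and> v \<in> module.span scl B} = UNIV"
    by blast
  ultimately show ?thesis unfolding finite_codim_def by blast
qed

lemma (in vector_space) finite_codim_UNIV: "finite_codim scale UNIV"
  unfolding finite_codim_def
proof (intro exI conjI)
  show "{w + v |w v. w \<in> UNIV \<and> v \<in> span {}} = UNIV"
    by auto
qed simp

lemma finite_codim_decompose:
  assumes "finite_codim scl W"
  obtains B where "finite B" and "\<And>y. \<exists>v\<in>module.span scl B. y - v \<in> W"
proof -
  obtain B where "finite B" and B: "{w + v | w v. w \<in> W \<and> v \<in> module.span scl B} = UNIV"
    using assms(1) unfolding finite_codim_def by blast
  have "\<exists>v\<in>module.span scl B. y - v \<in> W" for y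
  proof -
    have "y \<in> {w + v | w v. w \<in> W \<and> v \<in> module.span scl B}" using B by simp
    then obtain w v where "y = w + v" "w \<in> W" "v \<in> module.span scl B" by blast
    then show ?thesis by (intro bexI[of _ v]) simp_all
  qed
  with \<open>finite B\<close> that show thesis by blast
qed

lemma finite_codimI:
  assumes "finite B" and "\<And>y. \<exists>v\<in>module.span scl B. y - v \<in> W"
  shows "finite_codim scl W"
proof -
  have "y \<in> {w + v | w v. w \<in> W \<and> v \<in> module.span scl B}" for y
  proof -
    obtain v where "v \<in> module.span scl B" "y - v \<in> W" using assms(2) by blast
    moreover have "y = (y - v) + v" by simp
    ultimately show ?thesis by blast
  qed
  then show ?thesis unfolding finite_codim_def using assms(1) by blast
qed

text \<open>
  The quotient of \<open>U\<close> by the intersection embeds into the quotient by \<open>W\<close>, hence is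
  finite-dimensional. Since finite codimension is expressed by spanning sets, which do not restrict
  to subspaces, the proof first chooses a basis of the image of \<open>U\<close> in the span of
  representatives modulo \<open>W\<close> and lifts it to \<open>U\<close>.
\<close>

lemma (in vector_space_pair) finite_codim_Int_vimage:
  assumes T: "Vector_Spaces.linear s1 s2 T"
    and U: "vs1.subspace U" "finite_codim s1 U"
    and W: "vs2.subspace W" "finite_codim s2 W"
  shows "finite_codim s1 (U \<inter> T -` W)"
proof -
  interpret T: Vector_Spaces.linear s1 s2 T by (rule T)
  obtain B where B: "finite B" "\<And>y. \<exists>v\<in>vs2.span B. y - v \<in> W"
    using finite_codim_decompose[OF W(2)] by blast
  obtain E where E: "finite E" "\<And>y. \<exists>v\<in>vs1.span E. y - v \<in> U"
    using finite_codim_decompose[OF U(2)] by blast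
  \<comment> \<open>The representatives in the span of \<open>B\<close> of the classes that \<open>T\<close> attains on \<open>U\<close>.\<close>
  define Q where "Q = {u \<in> vs2.span B. \<exists>x\<in>U. T x - u \<in> W}"
  obtain C where C: "C \<subseteq> Q" "vs2.independent C" "Q \<subseteq> vs2.span C"
    using vs2.basis_exists[of Q] by metis
  have "finite C"
    using vs2.independent_span_bound[OF B(1) C(2)] C(1) unfolding Q_def by blast
  have "\<forall>c\<in>C. \<exists>x\<in>U. T x - c \<in> W"
    using C(1) unfolding Q_def by blast
  then obtain x where x: "\<And>c. c \<in> C \<Longrightarrow> x c \<in> U \<and> T (x c) - c \<in> W"
    by metis
  have lift: "\<exists>v \<in> vs1.span (x ` C). v \<in> U \<and> T v - u \<in> W" if "u \<in> vs2.span C" for u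
    using that
  proof (induction rule: vs2.span_induct_alt)
    case base
    show ?case
      using vs1.span_zero vs1.subspace_0[OF U(1)] vs2.subspace_0[OF W(1)] T.zero
      by (intro bexI[of _ 0]) auto
  next
    case (step r c u)
    obtain v where v: "v \<in> vs1.span (x ` C)" "v \<in> U" "T v - u \<in> W"
      using step by blast
    have "T (s1 r (x c) + v) - (s2 r c + u) = s2 r (T (x c) - c) + (T v - u)"
      by (simp add: T.add T.scale vs2.scale_right_diff_distrib)
    also have "\<dots> \<in> W"
      using x[OF step(1)] v(3) vs2.subspace_add[OF W(1)] vs2.subspace_scale[OF W(1)] by blast
    finally have "T (s1 r (x c) + v) - (s2 r c + u) \<in> W" .
    moreover have "s1 r (x c) + v \<in> U"
      using x[OF step(1)] v(2) vs1.subspace_add[OF U(1)] vs1.subspace_scale[OF U(1)] by blast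
    moreover have "s1 r (x c) + v \<in> vs1.span (x ` C)"
      using step(1) v(1) by (simp add: vs1.span_add vs1.span_base vs1.span_scale)
    ultimately show ?case by blast
  qed
  show ?thesis
  proof (rule finite_codimI[of "E \<union> x ` C"])
    show "finite (E \<union> x ` C)" using E(1) \<open>finite C\<close> by simp
    fix y
    obtain e where e: "e \<in> vs1.span E" "y - e \<in> U" using E(2) by blast
    obtain u where u: "u \<in> vs2.span B" "T (y - e) - u \<in> W" using B(2) by blast
    have "u \<in> vs2.span C" using u e(2) C(3) unfolding Q_def by blast
    then obtain v where v: "v \<in> vs1.span (x ` C)" "v \<in> U" "T v - u \<in> W"
      using lift by blast
    have "T (y - (e + v)) = (T (y - e) - u) - (T v - u)"
      by (simp add: T.diff T.add)
    also have "\<dots> \<in> W" using vs2.subspace_diff[OF W(1)] u(2) v(3) by blast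
    finally have "y - (e + v) \<in> T -` W" by simp
    moreover have "y - (e + v) \<in> U"
      using vs1.subspace_diff[OF U(1) e(2) v(2)] by (simp add: algebra_simps)
    moreover have "e + v \<in> vs1.span (E \<union> x ` C)"
      using e(1) v(1) vs1.span_mono[of E "E \<union> x ` C"] vs1.span_mono[of "x ` C" "E \<union> x ` C"]
      by (intro vs1.span_add) auto
    ultimately show "\<exists>v\<in>vs1.span (E \<union> x ` C). y - v \<in> U \<inter> T -` W" by blast
  qed
qed

lemma (in vector_space_pair) finite_codim_Int_vimages:
  assumes "finite S"
    and T: "\<And>i. i \<in> S \<Longrightarrow> Vector_Spaces.linear s1 s2 (T i)"
    and U: "vs1.subspace U" "finite_codim s1 U"
    and W: "vs2.subspace W" "finite_codim s2 W"
  shows "vs1.subspace {x \<in> U. \<forall>i\<in>S. T i x \<in> W} \<and> finite_codim s1 {x \<in> U. \<forall>i\<in>S. T i x \<in> W}"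
  using assms(1) T
proof (induction S)
  case empty
  then show ?case using U by simp
next
  case (insert i S)
  interpret T: Vector_Spaces.linear s1 s2 "T i" using insert by blast
  let ?V = "{x \<in> U. \<forall>i\<in>S. T i x \<in> W}"
  have eq: "{x \<in> U. \<forall>j\<in>insert i S. T j x \<in> W} = ?V \<inter> T i -` W"
    by auto
  have IH: "vs1.subspace ?V" "finite_codim s1 ?V"
    using insert by blast+
  have "vs1.subspace (T i -` W)"
    using T.subspace_vimage[OF W(1)] .
  then show ?case
    unfolding eq using finite_codim_Int_vimage[OF T.linear_axioms IH W] vs1.subspace_inter[OF IH(1)]
    by blast
qed

lemma (in vector_space) in_span_initial_segment:
  fixes u :: "nat \<Rightarrow> 'b"
  assumes "x \<in> span (u ` {..<n})"
  shows "\<exists>c. x = (\<Sum>i<n. scale (c i) (u i))"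
  using assms
proof (induction n arbitrary: x)
  case 0
  then show ?case by simp
next
  case (Suc n)
  then obtain k where "x - scale k (u n) \<in> span (u ` {..<n})"
    by (auto simp: lessThan_Suc span_breakdown_eq)
  then obtain c where "x - scale k (u n) = (\<Sum>i<n. scale (c i) (u i))"
    using Suc.IH by blast
  then have "x = (\<Sum>i<Suc n. scale ((c(n := k)) i) (u i))"
    by (simp add: algebra_simps)
  then show ?case by blast
qed

text \<open>
  Among infinitely many vectors some \<open>v n\<close> depends, modulo \<open>W\<close>, on its predecessors, as the
  quotient by \<open>W\<close> is finite-dimensional. For \<open>v i = f ^ i\<close> this is a monic polynomial
  relation of \<open>f\<close> modulo \<open>W\<close>.
\<close>

lemma (in vector_space) finite_codim_dependence:
  fixes v :: "nat \<Rightarrow> 'b"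
  assumes W: "subspace W" "finite_codim scale W"
  shows "\<exists>n c. c n = 1 \<and> (\<Sum>i\<le>n. scale (c i) (v i)) \<in> W"
proof -
  obtain B where B: "finite B" "\<And>y. \<exists>u\<in>span B. y - u \<in> W"
    using finite_codim_decompose[OF W(2)] by blast
  have "\<forall>i. \<exists>u. u \<in> span B \<and> v i - u \<in> W" using B(2) by blast
  from choice[OF this] obtain u where "\<forall>i. u i \<in> span B \<and> v i - u i \<in> W" ..
  then have u: "u i \<in> span B" "v i - u i \<in> W" for i by simp_all
  have "\<exists>n. u n \<in> span (u ` {..<n})"
  proof (rule ccontr)
    assume neg: "\<nexists>n. u n \<in> span (u ` {..<n})"
    have ind: "independent (u ` {..<n}) \<and> card (u ` {..<n}) = n" for n
    proof (induction n)
      case 0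
      show ?case by (simp add: independent_empty)
    next
      case (Suc n)
      have notin: "u n \<notin> span (u ` {..<n})" using neg by blast
      then have "u n \<notin> u ` {..<n}" using span_base[of "u n" "u ` {..<n}"] by argo
      then have "card (u ` {..<Suc n}) = Suc n"
        using Suc by (simp add: lessThan_Suc)
      moreover have "independent (u ` {..<Suc n})"
        using independent_insertI[OF notin] Suc by (simp add: lessThan_Suc)
      ultimately show ?case by blast
    qed
    have "u ` {..<Suc (card B)} \<subseteq> span B" using u(1) by blast
    then have "card (u ` {..<Suc (card B)}) \<le> card B"
      using independent_span_bound[OF B(1)] ind by blast
    then have "Suc (card B) \<le> card B"
      using ind by metis
    then show False by simp
  qed
  then obtain n c where c: "u n = (\<Sum>i<n. scale (c i) (u i))"
    using in_span_initial_segment by meson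
  let ?c = "\<lambda>i. if i = n then 1 else - c i"
  have "(\<Sum>i\<le>n. scale (?c i) (u i)) = 0"
    unfolding lessThan_Suc_atMost[symmetric] by (simp add: c sum_negf)
  then have "(\<Sum>i\<le>n. scale (?c i) (v i)) = (\<Sum>i\<le>n. scale (?c i) (v i - u i))"
    by (simp add: scale_right_diff_distrib sum_subtractf)
  also have "\<dots> \<in> W"
    using u(2) by (intro subspace_sum[OF W(1)] subspace_scale[OF W(1)])
  finally show ?thesis by (intro exI[of _ n] exI[of _ ?c]) simp
qed

section \<open>Ideals and derivations of a commutative algebra\<close>

lemma alg_idealD:
  assumes "alg_ideal I"
  shows alg_ideal_zero: "0 \<in> I"
    and alg_ideal_add: "f \<in> I \<Longrightarrow> g \<in> I \<Longrightarrow> f + g \<in> I"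
    and alg_ideal_mult: "g \<in> I \<Longrightarrow> f * g \<in> I"
  using assms unfolding alg_ideal_def submodule_def by auto

lemma alg_ideal_diff:
  assumes "alg_ideal I" "f \<in> I" "g \<in> I"
  shows "f - g \<in> I"
  using alg_ideal_add[OF assms(1,2) alg_ideal_mult[OF assms(1,3), of "-1"]] by simp

context commutative_algebra
begin

lemma scale_conv_mult: "scale r f = scale r 1 * f"
  using scale_mult_left[of r 1 f] by simp

lemma scale_mult_right: "f * scale r g = scale r (f * g)"
  by (metis mult.commute scale_mult_left)

lemma alg_ideal_subspace:
  assumes "alg_ideal I"
  shows "subspace I"
  by (rule subspaceI) (use alg_idealD[OF assms] scale_conv_mult in metis)+

text \<open>
  An ideal that contains one of finite codimension has itself finite codimension. So an element of
  \<open>max_ideals\<close> is maximal among all proper ideals, and the usual argument applies.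
\<close>

lemma max_ideal_prime:
  assumes J: "J \<in> max_ideals scale" and ab: "a * b \<in> J"
  shows "a \<in> J \<or> b \<in> J"
proof (rule ccontr)
  assume neg: "\<not> (a \<in> J \<or> b \<in> J)"
  have idJ: "alg_ideal J" and fcJ: "finite_codim scale J" using J unfolding max_ideals_def by auto
  define J' where "J' = {j + c * a | j c. j \<in> J}"
  have sub: "J \<subseteq> J'" 
  proof
    fix x assume "x \<in> J"
    moreover have "x = x + 0 * a" by simp
    ultimately show "x \<in> J'" unfolding J'_def by blast
  qed
  have "a = 0 + 1 * a" by simp
  then have "a \<in> J'" unfolding J'_def using alg_ideal_zero[OF idJ] by blast
  have "alg_ideal J'"
    unfolding alg_ideal_def submodule_def
  proof (intro conjI ballI allI)
    show "0 \<in> J'" using sub alg_ideal_zero[OF idJ] by blast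
  next
    fix x y assume "x \<in> J'" "y \<in> J'"
    then obtain j c k d where "x = j + c * a" "y = k + d * a" "j \<in> J" "k \<in> J"
      unfolding J'_def by blast
    then have "x + y = (j + k) + (c + d) * a" "j + k \<in> J"
      using alg_ideal_add[OF idJ] by (auto simp: algebra_simps)
    then show "x + y \<in> J'" unfolding J'_def by blast
  next
    fix f x assume "x \<in> J'"
    then obtain j c where "x = j + c * a" "j \<in> J" unfolding J'_def by blast
    then have "f * x = f * j + (f * c) * a" "f * j \<in> J"
      using alg_ideal_mult[OF idJ, of j f] by (simp_all add: algebra_simps)
    then show "f * x \<in> J'" unfolding J'_def by blast
  qed
  moreover have "J' \<noteq> J" using \<open>a \<in> J'\<close> neg by blast
  ultimately have "J' = UNIV"
    using J sub finite_codim_mono[OF fcJ sub] unfolding max_ideals_def by blast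
  then have "1 \<in> J'" by simp
  then obtain j c where "1 = j + c * a" "j \<in> J" unfolding J'_def by blast
  then have "b * 1 = b * (j + c * a)" by simp
  then have "b = b * j + c * (a * b)" by (simp add: algebra_simps)
  then show False
    using neg alg_ideal_add[OF idJ alg_ideal_mult[OF idJ] alg_ideal_mult[OF idJ ab]] \<open>j \<in> J\<close>
    by metis
qed

text \<open>
  Modulo \<open>y ^ 2\<close> the binomial expansion has only two terms, and both are divisible
  by \<open>x ^ m\<close>.
\<close>

lemma radical_add:
  fixes x y :: 'a
  assumes J: "alg_ideal J" and x: "x ^ m \<in> J" and y: "y ^ 2 \<in> J"
  shows "(x + y) ^ Suc m \<in> J"
proof -
  have "\<exists>a b. (x + y) ^ Suc n = (x + a * y) * x ^ n + b * y ^ 2" for n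
  proof (induction n)
    case 0
    show ?case by (intro exI[of _ 1] exI[of _ 0]) simp
  next
    case (Suc n)
    then obtain a b where ab: "(x + y) ^ Suc n = (x + a * y) * x ^ n + b * y ^ 2"
      by blast
    have "(x + y) ^ Suc (Suc n)
        = (x + (a + 1) * y) * x ^ Suc n + (a * x ^ n + (x + y) * b) * y ^ 2"
      unfolding power_Suc[of "x + y" "Suc n"] ab
      by (simp add: algebra_simps power2_eq_square)
    then show ?case by blast
  qed
  then obtain a b where "(x + y) ^ Suc m = (x + a * y) * x ^ m + b * y ^ 2"
    by blast
  then show ?thesis
    using alg_ideal_add[OF J] alg_ideal_mult[OF J] x y by simp
qed

text \<open>
  The span of \<open>t\<close> lies in the radical of \<open>J\<close>, and the radical contains \<open>1\<close> only if
  \<open>J\<close> does.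
\<close>

lemma one_in_ideal_if_squares:
  fixes J :: "'a set"
  assumes J: "alg_ideal J" and t: "finite t" "1 \<in> span t" and sq: "\<And>v. v \<in> t \<Longrightarrow> v ^ 2 \<in> J"
  shows "1 \<in> J"
proof -
  have "\<exists>m. x ^ m \<in> J" if "x \<in> span t" for x
    using that
  proof (induction rule: span_induct_alt)
    case base
    show ?case using alg_ideal_zero[OF J] by (intro exI[of _ 1]) simp
  next
    case (step r v x)
    then obtain m where "x ^ m \<in> J" by blast
    moreover have "(scale r v) ^ 2 \<in> J"
      using alg_ideal_mult[OF J sq[OF step(1)], of "scale r 1 * scale r 1"]
      by (subst scale_conv_mult) (simp add: power2_eq_square ac_simps)
    ultimately show ?case using radical_add[OF J] by (metis add.commute)
  qed
  from this[OF t(2)] show ?thesis by simp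
qed

lemma derivation_power:
  assumes "derivation scale D"
  shows "D (f ^ Suc n) = scale (of_nat (Suc n)) (f ^ n * D f)"
proof (induction n)
  case (Suc n)
  have two: "scale 2 g = g + g" for g
    using scale_left_distrib[of 1 1 g] by simp
  have "D (f ^ Suc (Suc n)) = D f * f ^ Suc n + f * D (f ^ Suc n)"
    using assms unfolding derivation_def by simp
  also have "\<dots> = scale (of_nat (Suc (Suc n))) (f ^ Suc n * D f)"
    unfolding Suc by (simp add: algebra_simps scale_mult_right scale_left_distrib two)
  finally show ?case .
qed simp

end

text \<open>
  Modulo the prime \<open>J\<close> this says that a derivation vanishes on an algebraic extension in
  characteristic zero, but \<open>D\<close> is not known to preserve \<open>J\<close>, and \<open>I\<close> need not be
  radical. The proof therefore considers polynomial relations \<open>p(f) * s \<in> I\<close> with a factor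
  \<open>s \<notin> J\<close>. Such relations exist with \<open>s = 1\<close> because the algebra has finite dimension
  modulo \<open>I\<close>. Applying \<open>D\<close> and multiplying by \<open>s\<close> yields
  \<open>p'(f) * (D f * s * s) \<in> I\<close>. If \<open>D f \<notin> J\<close>, this is again such a relation, of a
  degree smaller by one, and its leading coefficient is nonzero as the characteristic is zero.
  Continued down to degree zero this would put \<open>s\<close> into \<open>J\<close>.
\<close>

lemma derivation_into_prime:
  fixes scale :: "'r::field_char_0 \<Rightarrow> 'a::{comm_ring,comm_monoid_mult} \<Rightarrow> 'a"
  assumes A: "commutative_algebra scale" and D: "derivation scale D"
    and I: "alg_ideal I" "finite_codim scale I" and DI: "D ` I \<subseteq> I"
    and IJ: "I \<subseteq> J" and oneJ: "1 \<notin> J" and prime: "\<And>a b. a * b \<in> J \<Longrightarrow> a \<in> J \<or> b \<in> J"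
  shows "D f \<in> J"
proof -
  interpret commutative_algebra scale by (rule A)
  interpret D: Vector_Spaces.linear scale scale D
    using D unfolding derivation_def by blast
  have prod: "D (a * b) = D a * b + a * D b" for a b
    using D unfolding derivation_def by blast
  have sub: "subspace I" using alg_ideal_subspace[OF I(1)] .
  have descent: "D f \<in> J" if "s \<notin> J" "c n \<noteq> 0" "(\<Sum>i\<le>n. scale (c i) (f ^ i)) * s \<in> I" for n c s
    using that
  proof (induction n arbitrary: c s)
    case 0
    then have "scale (c 0) s \<in> I" by (simp add: scale_mult_left[symmetric])
    then have "scale (inverse (c 0)) (scale (c 0) s) \<in> I" by (rule subspace_scale[OF sub])
    then show ?case using 0 IJ by auto
  next
    case (Suc n)
    \<comment> \<open>\<open>q\<close> is the value at \<open>f\<close> of the derivative of the polynomial defining \<open>p\<close>.\<close>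
    define p where "p = (\<Sum>i\<le>Suc n. scale (c i) (f ^ i))"
    define d where "d i = of_nat (Suc i) * c (Suc i)" for i
    define q where "q = (\<Sum>i\<le>n. scale (d i) (f ^ i))"
    have D1: "D 1 = 0" using prod[of 1 1] by simp
    have "D p = (\<Sum>i\<le>Suc n. scale (c i) (D (f ^ i)))"
      unfolding p_def by (simp only: D.sum D.scale)
    also have "\<dots> = (\<Sum>i\<le>n. scale (c (Suc i)) (D (f ^ Suc i)))"
      by (simp add: sum.atMost_Suc_shift D1 del: power_Suc sum.atMost_Suc)
    also have "\<dots> = q * D f"
      unfolding q_def d_def sum_distrib_right derivation_power[OF D]
      by (intro sum.cong refl)
        (simp add: scale_mult_left[symmetric] scale_mult_right mult.commute del: of_nat_Suc)
    finally have Dp: "D p = q * D f" .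
    have ps: "p * s \<in> I" using Suc.prems(3) unfolding p_def .
    have eq: "q * (D f * s * s) = s * D (p * s) - D s * (p * s)"
      unfolding prod Dp by (simp add: algebra_simps)
    have mem: "q * (D f * s * s) \<in> I"
      unfolding eq
      using alg_ideal_diff[OF I(1) alg_ideal_mult[OF I(1)] alg_ideal_mult[OF I(1) ps]] DI ps
      by blast
    show ?case
    proof (rule ccontr)
      assume "D f \<notin> J"
      then have "D f * s * s \<notin> J" using prime Suc.prems(1) by blast
      moreover have "d n \<noteq> 0" unfolding d_def using Suc.prems(2) by (simp del: of_nat_Suc)
      ultimately show False using Suc.IH mem \<open>D f \<notin> J\<close> unfolding q_def by blast
    qed
  qed
  obtain n c where "c n = 1" "(\<Sum>i\<le>n. scale (c i) (f ^ i)) \<in> I"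
    using finite_codim_dependence[OF sub I(2), of "\<lambda>i. f ^ i"] by blast
  then show ?thesis using descent[of 1 c n] oneJ by simp
qed

section \<open>Subalgebras of a Lie pseudoalgebra\<close>

text \<open>For a subalgebra \<open>K\<close>, this is the kernel of the action of \<open>K\<close> on the quotient by \<open>K\<close>.\<close>

definition core :: "('l \<Rightarrow> 'l \<Rightarrow> 'l) \<Rightarrow> 'l set \<Rightarrow> 'l set"
  where "core bracket K = {X \<in> K. \<forall>Y. bracket X Y \<in> K}"

definition conductor :: "('a \<Rightarrow> 'l \<Rightarrow> 'l) \<Rightarrow> 'l set \<Rightarrow> 'a set"
  where "conductor act K = {f. \<forall>X. act f X \<in> K}"

context lie_pseudoalgebra
begin

sublocale L: vector_space "rscale scale act"
  by (rule vector_space_rscale) unfold_locales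

sublocale LL: vector_space_pair "rscale scale act" "rscale scale act" ..

sublocale AL: vector_space_pair scale "rscale scale act" ..

sublocale br: Vector_Spaces.linear "rscale scale act" "rscale scale act" "bracket X"
  by (rule bracket_linear_right)

sublocale bl: Vector_Spaces.linear "rscale scale act" "rscale scale act" "\<lambda>X. bracket X Y"
  by (rule bracket_linear_left)

lemma act_zero_left [simp]: "act 0 X = 0"
  using act_add_left[of 0 0 X] by simp

lemma act_zero_right [simp]: "act f 0 = 0"
  using act_add_right[of f 0 0] by simp

lemma act_minus_right: "act f (- X) = - act f X"
  using act_add_right[of f X "- X"] by (simp add: eq_neg_iff_add_eq_0 add.commute)

lemma bracket_skew: "bracket X Y = - bracket Y X"
  using bracket_alternating[of "X + Y"] bracket_alternating[of X] bracket_alternating[of Y]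
  by (simp add: br.add bl.add eq_neg_iff_add_eq_0 add.commute)

lemma bracket_act_left: "bracket (act f X) Y = act f (bracket X Y) - act (anchor Y f) X"
proof -
  have "bracket (act f X) Y = - (act f (bracket Y X) + act (anchor Y f) X)"
    by (subst bracket_skew) (simp add: bracket_act)
  then show ?thesis by (subst bracket_skew[of X Y]) (simp add: act_minus_right)
qed

text \<open>The Jacobi identity in the form in which it shows that \<open>core\<close> is closed under the bracket.\<close>

lemma bracket_bracket_left:
  "bracket (bracket X Y) Z = bracket X (bracket Y Z) - bracket Y (bracket X Z)"
proof -
  have "bracket (bracket X Y) Z = - bracket Z (bracket X Y)"
    by (rule bracket_skew)
  also have "\<dots> = bracket X (bracket Y Z) + bracket Y (bracket Z X)"
    using jacobi[of X Y Z] by (simp add: minus_unique add.commute)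
  also have "bracket Y (bracket Z X) = - bracket Y (bracket X Z)"
    by (subst bracket_skew[of Z X]) (simp add: br.neg)
  finally show ?thesis by simp
qed

lemma linear_act_left: "Vector_Spaces.linear scale (rscale scale act) (\<lambda>h. act h X)"
proof
  show "act (scale r h) X = rscale scale act r (act h X)" for r h
    unfolding rscale_def act_act by (metis scale_conv_mult)
qed (rule act_add_left)

lemma act_diff_left: "act (f - g) X = act f X - act g X"
  using act_add_left[of "f - g" g X] by simp

abbreviation subalgebra :: "'l set \<Rightarrow> bool"
  where "subalgebra \<equiv> lie_subalgebra (rscale scale act) bracket"

lemma subalgebraD:
  assumes "subalgebra K"
  shows subalgebra_subspace: "L.subspace K"
    and subalgebra_bracket: "X \<in> K \<Longrightarrow> Y \<in> K \<Longrightarrow> bracket X Y \<in> K"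
  using assms unfolding lie_subalgebra_def by auto

text \<open>
  For \<open>X \<in> K\<close> the condition \<open>[X, Y] \<in> K\<close> depends only on the class of \<open>Y\<close> modulo
  \<open>K\<close>, so it suffices to impose it for finitely many representatives \<open>Y\<close>. Each of these
  conditions cuts out a subspace of finite codimension.
\<close>

lemma core_finite_codim:
  assumes K: "subalgebra K" and fc: "finite_codim (rscale scale act) K"
  shows "subalgebra (core bracket K)" and "finite_codim (rscale scale act) (core bracket K)"
proof -
  note sub = subalgebra_subspace[OF K]
  obtain B where B: "finite B" "\<And>Y. \<exists>v\<in>L.span B. Y - v \<in> K"
    using finite_codim_decompose[OF fc] by blast
  have eq: "core bracket K = {X \<in> K. \<forall>b\<in>B. bracket X b \<in> K}"
  proof (intro equalityI subsetI)
    fix X assume X: "X \<in> {X \<in> K. \<forall>b\<in>B. bracket X b \<in> K}"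
    have "bracket X Y \<in> K" for Y
    proof -
      obtain v where v: "v \<in> L.span B" "Y - v \<in> K" using B(2) by blast
      have "B \<subseteq> bracket X -` K" using X by blast
      then have "bracket X v \<in> K"
        using L.span_minimal[OF _ br.subspace_vimage[OF sub]] v(1) by blast
      moreover have "bracket X (Y - v) \<in> K" using X v(2) subalgebra_bracket[OF K] by blast
      moreover have "bracket X Y = bracket X (Y - v) + bracket X v" by (simp add: br.diff)
      ultimately show ?thesis using L.subspace_add[OF sub] by metis
    qed
    then show "X \<in> core bracket K" using X unfolding core_def by blast
  qed (auto simp: core_def)
  have *: "L.subspace (core bracket K) \<and> finite_codim (rscale scale act) (core bracket K)"
    unfolding eq
    by (rule LL.finite_codim_Int_vimages[where T = "\<lambda>b X. bracket X b"])
       (use B(1) sub fc bracket_linear_left in auto)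
  then show "finite_codim (rscale scale act) (core bracket K)" ..
  show "subalgebra (core bracket K)"
    unfolding lie_subalgebra_def
  proof (intro conjI ballI)
    show "L.subspace (core bracket K)" using * ..
    fix X Y assume "X \<in> core bracket K" "Y \<in> core bracket K"
    then show "bracket X Y \<in> core bracket K"
      unfolding core_def using L.subspace_diff[OF sub] by (simp add: bracket_bracket_left)
  qed
qed

lemma conductor_ideal:
  assumes "L.subspace K"
  shows "alg_ideal (conductor act K)"
  unfolding alg_ideal_def submodule_def
proof (intro conjI ballI allI)
  show "0 \<in> conductor act K"
    unfolding conductor_def using L.subspace_0[OF assms] by simp
  show "f + g \<in> conductor act K" if "f \<in> conductor act K" "g \<in> conductor act K" for f g
    using that L.subspace_add[OF assms] unfolding conductor_def by (simp add: act_add_left)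
  show "g * f \<in> conductor act K" if "f \<in> conductor act K" for f g
    using that unfolding conductor_def by (simp add: mult.commute[of g f] act_act[symmetric])
qed

text \<open>
  \<open>K\<close> is only a linear subspace. The submodule generated by the products is caught inside the
  largest submodule contained in \<open>K\<close>.
\<close>

lemma ideal_times_conductor:
  assumes "L.subspace K"
  shows "ideal_times act (conductor act K) \<subseteq> K"
proof -
  let ?N = "{Z. \<forall>g. act g Z \<in> K}"
  have "submodule act ?N"
    unfolding submodule_def using L.subspace_0[OF assms] L.subspace_add[OF assms]
    by (auto simp: act_add_right act_act)
  moreover have "{act f X | f X. f \<in> conductor act K} \<subseteq> ?N"
  proof clarify
    fix f X g
    assume "f \<in> conductor act K"
    moreover have "act g (act f X) = act f (act g X)"
      by (simp add: act_act mult.commute)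
    ultimately show "act g (act f X) \<in> K" unfolding conductor_def by simp
  qed
  ultimately have "ideal_times act (conductor act K) \<subseteq> ?N"
    unfolding ideal_times_def by (intro hull_minimal)
  also have "?N \<subseteq> K" using act_one by (metis (mono_tags, lifting) mem_Collect_eq subsetI)
  finally show ?thesis .
qed

text \<open>In \<open>[X, f Y] = f [X, Y] + X(f) Y\<close> the first two terms lie in \<open>K\<close>,
  as \<open>f\<close> multiplies everything into \<open>K\<close>.\<close>

lemma anchor_preserves_conductor:
  assumes K: "subalgebra K" and X: "X \<in> K" and f: "f \<in> conductor act K"
  shows "anchor X f \<in> conductor act K"
proof -
  have "act (anchor X f) Y \<in> K" for Y
  proof -
    have "act (anchor X f) Y = bracket X (act f Y) - act f (bracket X Y)"
      by (simp add: bracket_act)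
    also have "\<dots> \<in> K"
      using f X subalgebra_bracket[OF K] L.subspace_diff[OF subalgebra_subspace[OF K]]
      unfolding conductor_def by blast
    finally show ?thesis .
  qed
  then show ?thesis unfolding conductor_def by blast
qed

text \<open>
  In \<open>[Z, g Y] = g [Z, Y] + Z(g) Y\<close> the left side lies in \<open>K\<close>. The term \<open>g [Z, Y]\<close>
  equals \<open>[g Z, Y] + Y(g) Z\<close>, which lies in \<open>K\<close> since \<open>g Z\<close> and \<open>Y(g) Z\<close> are
  multiples of \<open>Z\<close>.
\<close>

lemma anchor_in_conductor:
  assumes K: "L.subspace K" and Z: "\<And>g. act g Z \<in> core bracket K"
  shows "anchor Z g \<in> conductor act K"
proof -
  have "act (anchor Z g) Y \<in> K" for Y
  proof -
    have Z': "act h Z \<in> K" "bracket (act h Z) W \<in> K" for h W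
      using Z[of h] unfolding core_def by auto
    have "act (anchor Z g) Y = bracket (act 1 Z) (act g Y) - bracket (act g Z) Y - act (anchor Y g) Z"
      by (simp add: act_one bracket_act bracket_act_left)
    also have "\<dots> \<in> K"
      using Z' L.subspace_diff[OF K] by blast
    finally show ?thesis .
  qed
  then show ?thesis unfolding conductor_def by blast
qed

end

lemma (in lie_pseudoalgebra) bracket_multiples:
  "bracket (act a X) (act b X) = act (a * anchor X b - b * anchor X a) X"
  by (simp add: bracket_act bracket_act_left bracket_alternating anchor_act act_act act_diff_left
      act_minus_right)

text \<open>
  All brackets of multiples of one element \<open>X\<close> are multiples of \<open>X\<close>. The combination
  \<open>[h X, f g X] - [h f X, g X]\<close> is chosen so that the derivatives of \<open>g\<close> and \<open>h\<close>
  cancel, leaving \<open>2 g h X(f) X\<close>. The factor \<open>g\<close> is arbitrary because it sits only in the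
  second arguments, on which membership in \<open>core\<close> imposes no condition.
\<close>

lemma anchor_multiple_in_subalgebra:
  fixes scale :: "'r::field_char_0 \<Rightarrow> 'a::{comm_ring,comm_monoid_mult} \<Rightarrow> 'a"
  assumes "lie_pseudoalgebra scale act bracket anchor"
    and K: "module.subspace (rscale scale act) K"
    and hX: "act h X \<in> core bracket K" and hfX: "act h (act f X) \<in> core bracket K"
  shows "act g (act (h * anchor X f) X) \<in> K"
proof -
  interpret lie_pseudoalgebra scale act bracket anchor by fact
  let ?Z = "act g (act (h * anchor X f) X)"
  have prod: "anchor X (a * b) = anchor X a * b + a * anchor X b" for a b
    using anchor_derivation[of X] unfolding derivation_def by blast
  have "h * anchor X (f * g) - (f * g) * anchor X h
      - ((h * f) * anchor X g - g * anchor X (h * f))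
    = g * (h * anchor X f) + g * (h * anchor X f)"
    by (simp add: prod algebra_simps)
  then have "bracket (act h X) (act (f * g) X) - bracket (act h (act f X)) (act g X) = ?Z + ?Z"
    by (simp only: act_act bracket_multiples act_diff_left[symmetric] act_add_left[symmetric])
  then have "?Z + ?Z \<in> K"
    using hX hfX L.subspace_diff[OF K] unfolding core_def by (metis (mono_tags) mem_Collect_eq)
  then have "rscale scale act (1 / 2) (?Z + ?Z) \<in> K"
    by (rule L.subspace_scale[OF K])
  moreover have "rscale scale act (1 / 2) (?Z + ?Z) = rscale scale act (1 / 2 + 1 / 2) ?Z"
    unfolding L.scale_right_distrib L.scale_left_distrib ..
  ultimately show ?thesis by simp
qed

text \<open>
  A subspace \<open>U\<close> of finite codimension inside the conductor is obtained by requiring, for the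
  finitely many \<open>X\<close> and \<open>f\<close> that represent \<open>1\<close>, that \<open>h X\<close> and \<open>h f X\<close> lie in the
  core of the core. Two steps of \<open>core\<close> are needed: one is used up by
  \<open>anchor_multiple_in_subalgebra\<close>, the other by \<open>anchor_in_conductor\<close>.
\<close>

lemma conductor_finite_codim:
  fixes scale :: "'r::field_char_0 \<Rightarrow> 'a::{comm_ring,comm_monoid_mult} \<Rightarrow> 'a"
  assumes "lie_pseudoalgebra scale act bracket anchor"
    and nonsing: "strongly_nonsingular scale anchor"
    and K: "lie_subalgebra (rscale scale act) bracket K"
    and fc: "finite_codim (rscale scale act) K"
  shows "finite_codim scale (conductor act K)"
proof -
  interpret lie_pseudoalgebra scale act bracket anchor by fact
  let ?I = "conductor act K"
  let ?K1 = "core bracket K"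
  let ?K2 = "core bracket ?K1"
  note K1 = core_finite_codim[OF K fc]
  note K2 = core_finite_codim[OF K1]
  have idI: "alg_ideal ?I" using conductor_ideal[OF subalgebra_subspace[OF K]] .
  have "1 \<in> span {anchor X f | X f. True}"
    using nonsing unfolding strongly_nonsingular_def by simp
  then obtain t c where t: "finite t" "t \<subseteq> {anchor X f | X f. True}"
    and one: "1 = (\<Sum>v\<in>t. scale (c v) v)"
    unfolding span_explicit by blast
  have span: "1 \<in> span t"
    unfolding one by (intro span_sum span_scale span_base)
  have "\<forall>v\<in>t. \<exists>X f. v = anchor X f" using t(2) by blast
  then obtain X f where Xf: "\<And>v. v \<in> t \<Longrightarrow> v = anchor (X v) (f v)" by metis
  define S where "S = X ` t \<union> (\<lambda>v. act (f v) (X v)) ` t"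
  define U where "U = {h \<in> UNIV. \<forall>Y\<in>S. act h Y \<in> ?K2}"
  have "finite_codim scale U"
    unfolding U_def
    using AL.finite_codim_Int_vimages[where T = "\<lambda>Y h. act h Y", OF _ linear_act_left
        subspace_UNIV finite_codim_UNIV subalgebra_subspace[OF K2(1)] K2(2), of S] t(1)
    unfolding S_def by blast
  moreover have "U \<subseteq> ?I"
  proof
    fix h assume h: "h \<in> U"
    \<comment> \<open>This ideal contains \<open>1\<close> exactly if \<open>h\<close> lies in the conductor.\<close>
    define J where "J = {a. a * h \<in> ?I}"
    have "alg_ideal J"
      unfolding alg_ideal_def submodule_def J_def
      using alg_idealD[OF idI] by (auto simp: distrib_right mult.assoc)
    moreover have "v ^ 2 \<in> J" if v: "v \<in> t" for v
    proof -
      have "act h (X v) \<in> ?K2" "act h (act (f v) (X v)) \<in> ?K2"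
        using h v unfolding U_def S_def by auto
      then have "act g (act (h * anchor (X v) (f v)) (X v)) \<in> ?K1" for g
        by (rule anchor_multiple_in_subalgebra[OF assms(1) subalgebra_subspace[OF K1(1)]])
      then have "anchor (act (h * anchor (X v) (f v)) (X v)) (f v) \<in> ?I"
        by (rule anchor_in_conductor[OF subalgebra_subspace[OF K]])
      then show ?thesis
        unfolding J_def anchor_act Xf[OF v, symmetric] by (simp add: power2_eq_square ac_simps)
    qed
    ultimately have "1 \<in> J" using one_in_ideal_if_squares t(1) span by blast
    then show "h \<in> ?I" unfolding J_def by simp
  qed
  ultimately show ?thesis by (rule finite_codim_mono)
qed

theorem theorem6:
  fixes scale :: "'r::field_char_0 \<Rightarrow> 'a::{comm_ring,comm_monoid_mult} \<Rightarrow> 'a"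
    and act :: "'a \<Rightarrow> 'l::ab_group_add \<Rightarrow> 'l"
    and bracket :: "'l \<Rightarrow> 'l \<Rightarrow> 'l"
    and anchor :: "'l \<Rightarrow> 'a \<Rightarrow> 'a"
    and K :: "'l set"
  assumes "lie_pseudoalgebra scale act bracket anchor"
    and "strongly_nonsingular scale anchor"
    and "lie_subalgebra (rscale scale act) bracket K"
    and "finite_codim (rscale scale act) K"
  shows "\<exists>I. alg_ideal I \<and> finite_codim scale I \<and>
    ideal_times act I \<subseteq> K \<and> K \<subseteq> anchor_into anchor (ideal_bar scale I)"
proof -
  interpret lie_pseudoalgebra scale act bracket anchor by fact
  let ?I = "conductor act K"
  note sub = subalgebra_subspace[OF assms(3)]
  have idI: "alg_ideal ?I" using conductor_ideal[OF sub] .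
  have fcI: "finite_codim scale ?I" using conductor_finite_codim[OF assms] .
  have "anchor X g \<in> J" if X: "X \<in> K" and J: "J \<in> max_ideals scale" and IJ: "?I \<subseteq> J" for X g J
  proof (rule derivation_into_prime[OF commutative_algebra_axioms anchor_derivation idI fcI _ IJ])
    show "anchor X ` ?I \<subseteq> ?I" using anchor_preserves_conductor[OF assms(3) X] by blast
    have "alg_ideal J" "J \<noteq> UNIV" using J unfolding max_ideals_def by auto
    then show "1 \<notin> J" using alg_ideal_mult[of J 1] by auto
  qed (rule max_ideal_prime[OF J])
  then have "K \<subseteq> anchor_into anchor (ideal_bar scale ?I)"
    unfolding anchor_into_def ideal_bar_def zero_locus_def by auto
  then show ?thesis using idI fcI ideal_times_conductor[OF sub] by blast
qed

end
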